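(* Let $X_n$ be the number of correct guesses in the no-feedback card guessing game after a single Gilbert–Shannon–Reeds riffle shuffle of an ordered deck of $n$ cards, when the guesser follows the strategy $\mathcal{G}^{\ast}$ described in the context. Then, as $n\to\infty$, \[ \frac{X_n}{\sqrt{n}} \xrightarrow{\ d\ } H_1+H_2, \] where $H_1,H_2$ are independent, identically distributed half-normal random variables, each with density $f_H(x)=\frac{2}{\sqrt{\pi}}e^{-x^2}$ for $x\ge 0$. Equivalently, the limit $H_1+H_2$ is supported on $[0,\infty)$ and has density \[ f(x)=4\varphi(x)\big(2\Phi(x)-1\big),\qquad x\ge 0, \] where $\varphi(x)=\frac{1}{\sqrt{2\pi}}e^{-x^2/2}$ and $\Phi(x)=\int_{-\infty}^x\varphi(t)\,dt$.
   Context: Riffle shuffle (Gilbert–Shannon–Reeds model): a deck of $n$ cards labeled $1,\dots,n$ from top to bottom is cut at position $k$ (the first packet consists of cards $1,\dots,k$, the second of cards $k+1,\dots,n$) with probability $\binom{n}{k}/2^n$, $0\le k\le n$. The two packets are then interleaved: while $m_1$ cards remain in the first packet and $m_2$ in the second, the next card is taken from the first packet with probability $m_1/(m_1+m_2)$ and from the second with probability $m_2/(m_1+m_2)$. Equivalently, given the cut, each of the $\binom{n}{k}$ interleavings preserving the relative order within each packet is equally likely. Let $\sigma(j)$ be the label of the card at position $j$ (from the top) of the resulting deck. No-feedback game: the guesser makes a guess $g_j$ for each position $j=1,\dots,n$ without any information about the deck or about correctness of earlier guesses. The strategy $\mathcal{G}^{\ast}=(g_1,\dots,g_n)$ guesses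 the top half of the deck with the sequence $1,2,2,3,3,4,4,\dots$ and the bottom half with the sequence $\dots,n-3,n-3,n-2,n-2,n-1,n-1,n$; precisely, with $h=\lceil n/2\rceil$, $g_j=\lfloor j/2\rfloor+1$ for $1\le j\le h$ and $g_j=n-\lfloor (n-j+1)/2\rfloor$ for $h<j\le n$. Then $X_n=\#\{j:\sigma(j)=g_j\}$. *)

theory Defs
  imports "HOL-Probability.Probability"
begin

text \<open>Decks and packets are lists from top to bottom.\<close>

fun riffle :: "'a list \<Rightarrow> 'a list \<Rightarrow> 'a list pmf" where
  "riffle [] ys = return_pmf ys"
| "riffle xs [] = return_pmf xs"
| "riffle (x # xs) (y # ys) =
     do {
       b \<leftarrow> bernoulli_pmf (real (length (x # xs)) / real (length (x # xs) + length (y # ys)));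
       if b then map_pmf ((#) x) (riffle xs (y # ys))
       else map_pmf ((#) y) (riffle (x # xs) ys)
     }"

definition gsr_shuffle :: "nat \<Rightarrow> nat list pmf" where
  "gsr_shuffle n =
     do {
       k \<leftarrow> binomial_pmf n (1 / 2);
       riffle [1..<k+1] [k+1..<n+1]
     }"

text \<open>Positions in the deck are numbered from 1, list indices from 0.\<close>

definition card_at :: "nat list \<Rightarrow> nat \<Rightarrow> nat" where
  "card_at deck j = deck ! (j - 1)"

definition guess :: "nat \<Rightarrow> nat \<Rightarrow> nat" where
  "guess n j = (if j \<le> nat \<lceil>real n / 2\<rceil> then j div 2 + 1 else n - (n - j + 1) div 2)"

definition correct_guesses :: "nat \<Rightarrow> nat list \<Rightarrow> nat" where
  "correct_guesses n deck = card {j \<in> {1..n}. card_at deck j = guess n j}"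

definition half_normal_density :: "real \<Rightarrow> real" where
  "half_normal_density x = (if 0 \<le> x then 2 / sqrt pi * exp (- x\<^sup>2) else 0)"

definition std_normal_cdf :: "real \<Rightarrow> real" where
  "std_normal_cdf x = (LINT t:{..x}|lborel. std_normal_density t)"

definition limit_density :: "real \<Rightarrow> real" where
  "limit_density x =
     (if 0 \<le> x then 4 * std_normal_density x * (2 * std_normal_cdf x - 1) else 0)"

lemma riffle_eq_pmf_of_set:
  assumes "distinct (xs @ ys)"
  shows "riffle xs ys = pmf_of_set (shuffles xs ys)"
  using assms
proof (induction xs ys rule: riffle.induct)
  case (3 x xs y ys)
  let ?A = "shuffles xs (y # ys)" and ?B = "shuffles (x # xs) ys"
  let ?S = "shuffles (x # xs) (y # ys)"
  let ?a = "length xs" and ?b = "length ys"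
  have IH: "riffle xs (y # ys) = pmf_of_set ?A" "riffle (x # xs) ys = pmf_of_set ?B"
    using 3 by auto
  have neq: "x \<noteq> y" using 3 by auto
  have fin: "finite ?A" "finite ?B" "?A \<noteq> {}" "?B \<noteq> {}" "finite ?S" "?S \<noteq> {}"
    using splice_in_shuffles[of xs "y # ys"] splice_in_shuffles[of "x # xs" ys]
    by (auto simp del: splice.simps)
  have cA: "card ?A = (?a + Suc ?b) choose ?a"
    using 3(3) by (subst card_disjoint_shuffles) auto
  have cB: "card ?B = (Suc ?a + ?b) choose Suc ?a"
    using 3(3) by (subst card_disjoint_shuffles) auto
  have cS: "card ?S = (Suc ?a + Suc ?b) choose Suc ?a"
    using 3(3) by (subst card_disjoint_shuffles) auto
  have eA: "Suc ?a * card ?S = (Suc ?a + Suc ?b) * card ?A"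
    unfolding cA cS using Suc_times_binomial[of ?a "?a + Suc ?b"] by simp
  have sum: "card ?S = card ?A + card ?B"
    unfolding cA cB cS by simp
  have eB: "Suc ?b * card ?S = (Suc ?a + Suc ?b) * card ?B"
  proof -
    have "Suc ?b * card ?S + Suc ?a * card ?S = (Suc ?a + Suc ?b) * card ?B + Suc ?a * card ?S"
    proof -
      have "Suc ?b * card ?S + Suc ?a * card ?S = (Suc ?a + Suc ?b) * card ?S"
        by (simp only: add_mult_distrib add.commute)
      also have "\<dots> = (Suc ?a + Suc ?b) * card ?B + (Suc ?a + Suc ?b) * card ?A"
        by (simp only: sum add_mult_distrib2 add.commute)
      finally show ?thesis by (simp only: eA)
    qed
    thus ?thesis by (simp only: add_right_cancel)
  qed
  have pos: "real (card ?A) > 0" "real (card ?B) > 0" "real (card ?S) > 0"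
    using fin by (simp_all add: card_gt_0_iff del: shuffles.simps)
  define p where "p = real (Suc ?a) / real (Suc ?a + Suc ?b)"
  have p01: "p \<in> {0..1}" and q: "1 - p = real (Suc ?b) / real (Suc ?a + Suc ?b)"
    unfolding p_def by (auto simp: field_simps)
  have frac: "u / v / r = 1 / t" if "v > 0" "r > 0" "t > 0" "u * t = v * r" for u v r t :: real
    using that by (simp add: divide_simps mult_ac)
  have pA: "p / real (card ?A) = 1 / real (card ?S)"
  proof -
    have "real (Suc ?a) * real (card ?S) = real (Suc ?a + Suc ?b) * real (card ?A)"
      using eA by (metis of_nat_mult)
    thus ?thesis unfolding p_def by (rule frac[rotated -1]) (use pos in simp_all)
  qed
  have pB: "(1 - p) / real (card ?B) = 1 / real (card ?S)"
  proof -
    have "real (Suc ?b) * real (card ?S) = real (Suc ?a + Suc ?b) * real (card ?B)"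
      using eB by (metis of_nat_mult)
    thus ?thesis unfolding q by (rule frac[rotated -1]) (use pos in simp_all)
  qed
  show ?case
  proof (rule pmf_eqI)
    fix zs
    have "pmf (riffle (x # xs) (y # ys)) zs =
        p * pmf (map_pmf ((#) x) (pmf_of_set ?A)) zs + (1 - p) * pmf (map_pmf ((#) y) (pmf_of_set ?B)) zs"
      using p01 by (simp add: IH pmf_bind p_def)
    also have "map_pmf ((#) x) (pmf_of_set ?A) = pmf_of_set ((#) x ` ?A)"
      using fin by (intro map_pmf_of_set_inj) auto
    also have "map_pmf ((#) y) (pmf_of_set ?B) = pmf_of_set ((#) y ` ?B)"
      using fin by (intro map_pmf_of_set_inj) auto
    also have "p * pmf (pmf_of_set ((#) x ` ?A)) zs + (1 - p) * pmf (pmf_of_set ((#) y ` ?B)) zs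
        = p / real (card ?A) * indicator ((#) x ` ?A) zs + (1 - p) / real (card ?B) * indicator ((#) y ` ?B) zs"
      using fin by (simp add: card_image del: shuffles.simps)
    also have "\<dots> = indicator ?S zs / real (card ?S)"
      unfolding pA pB using neq by (auto simp: indicator_def)
    also have "\<dots> = pmf (pmf_of_set ?S) zs"
      using fin by (simp del: shuffles.simps)
    finally show "pmf (riffle (x # xs) (y # ys)) zs = pmf (pmf_of_set ?S) zs" .
  qed
qed (simp_all add: pmf_of_set_singleton)

end

theory Submission
  imports Defs "HOL-Real_Asymp.Real_Asymp"
begin

text \<open>
  A shuffle is driven by \<open>n\<close> fair bits, one per position, telling which packet the card comes
  from. Let \<open>S\<close> be the simple random walk of the bits. In the top half a guess is correct, apart
  from at most two positions, iff \<open>S\<close> steps up from \<open>0\<close> or from \<open>1\<close> there (a hit). Read from the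
  bottom with complemented bits, the bottom half has the same description, so \<open>X\<^sub>n\<close> is, up to
  \<open>4\<close>, the sum of two independent hit counts of walks of length about \<open>n / 2\<close>.

  The number of hits differs from the number of crossings of the edge between \<open>0\<close> and \<open>1\<close> by a
  martingale whose second moment is \<open>E \<bar>S - 1\<bar> - 1 = O(sqrt n)\<close>, hence by a negligible amount.
  The number of crossings has exactly the law of \<open>\<bar>S + 1 / 2\<bar> - 1 / 2\<close> (a discrete form of
  Levy's identity between local time and maximum, with the reflection principle built in). The
  central limit theorem for \<open>S\<close> then gives a half-normal limit for each half of the deck.
\<close>

section \<open>Expectations over fair bits\<close>

abbreviation bits :: "nat \<Rightarrow> bool list pmf" where
  "bits n \<equiv> replicate_pmf n (bernoulli_pmf (1 / 2))"

declare replicate_pmf.simps(2) [simp del]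

abbreviation mean :: "nat \<Rightarrow> (bool list \<Rightarrow> 'b) \<Rightarrow> 'b::{banach, second_countable_topology}" where
  "mean n f \<equiv> measure_pmf.expectation (bits n) f"

lemma finite_lists_length: "finite {bs :: bool list. length bs = n}"
  using finite_lists_length_eq[of "UNIV :: bool set" n] by simp

lemma set_bits: "set_pmf (bits n) = {bs. length bs = n}"
  by (auto simp: set_replicate_pmf set_pmf_bernoulli)

lemma integrable_bits [simp]:
  fixes f :: "bool list \<Rightarrow> 'b::{banach, second_countable_topology}"
  shows "integrable (measure_pmf (bits n)) f"
  by (intro integrable_measure_pmf_finite) (simp add: set_bits finite_lists_length)

text \<open>Conditioning on the head of the list. For \<open>walk\<close> the head is the newest
  step, so the integrand on the right averages over the next step given the past.\<close>

lemma mean_Suc: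
  fixes f :: "bool list \<Rightarrow> 'b::{banach, second_countable_topology}"
  shows "mean (Suc n) f = mean n (\<lambda>bs. f (True # bs) + f (False # bs)) /\<^sub>R 2"
proof -
  have "bits (Suc n) = bernoulli_pmf (1/2) \<bind> (\<lambda>b. map_pmf ((#) b) (bits n))"
    by (simp add: map_pmf_def replicate_pmf.simps)
  then have "mean (Suc n) f =
      (\<Sum>b\<in>UNIV. pmf (bernoulli_pmf (1/2)) b *\<^sub>R measure_pmf.expectation (map_pmf ((#) b) (bits n)) f)"
    by (simp) (subst pmf_expectation_bind[of UNIV]; simp add: set_bits finite_lists_length)
  then show ?thesis
    by (simp add: UNIV_bool scaleR_add_right add.commute
        Bochner_Integration.integral_add[OF integrable_bits integrable_bits])
qed

lemma mean_mono:
  fixes f g :: "bool list \<Rightarrow> real"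
  assumes "\<And>bs. length bs = n \<Longrightarrow> f bs \<le> g bs"
  shows "mean n f \<le> mean n g"
  by (intro integral_mono_AE) (auto simp: AE_measure_pmf_iff set_bits assms)

section \<open>Random walk, hits and crossings\<close>

text \<open>The head of a list of bits is the most recent step of the walk. A hit is an up-step from
  \<open>0\<close> or \<open>1\<close>; a crossing is a step between \<open>0\<close> and \<open>1\<close>, in either direction.\<close>

primrec walk :: "bool list \<Rightarrow> int" where
  "walk [] = 0"
| "walk (b # bs) = walk bs + (if b then 1 else - 1)"

primrec hits :: "bool list \<Rightarrow> int" where
  "hits [] = 0"
| "hits (b # bs) = hits bs + of_bool (b \<and> walk bs \<in> {0, 1})"

primrec crossings :: "bool list \<Rightarrow> int" where
  "crossings [] = 0"
| "crossings (b # bs) = crossings bs + of_bool (walk bs = (if b then 0 else 1))"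

lemma crossings_nonneg: "crossings bs \<ge> 0"
  by (induction bs) auto

section \<open>Second-moment comparison of hits and crossings\<close>

lemma mean_walk_square: "mean n (\<lambda>bs. (real_of_int (walk bs))\<^sup>2) = real n"
proof (induction n)
  case (Suc n)
  have "mean (Suc n) (\<lambda>bs. (real_of_int (walk bs))\<^sup>2)
      = (mean n (\<lambda>bs. (real_of_int (walk bs) + 1)\<^sup>2 + (real_of_int (walk bs) - 1)\<^sup>2)) / 2"
    unfolding mean_Suc by simp
  also have "\<dots> = (mean n (\<lambda>bs. 2 * (real_of_int (walk bs))\<^sup>2 + 2)) / 2"
    by (simp add: power2_eq_square algebra_simps)
  also have "\<dots> = real (Suc n)" by (simp add: Suc)
  finally show ?case .
qed simp

text \<open>Nonnegativity of the variance of the absolute value.\<close>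

lemma mean_abs_le:
  fixes f :: "bool list \<Rightarrow> real"
  shows "mean n (\<lambda>bs. \<bar>f bs\<bar>) \<le> sqrt (mean n (\<lambda>bs. (f bs)\<^sup>2))"
proof (rule real_le_rsqrt)
  have "0 \<le> measure_pmf.variance (bits n) (\<lambda>bs. \<bar>f bs\<bar>)" by simp
  also have "\<dots> = mean n (\<lambda>bs. (f bs)\<^sup>2) - (mean n (\<lambda>bs. \<bar>f bs\<bar>))\<^sup>2"
    by (subst measure_pmf.variance_eq) auto
  finally show "(mean n (\<lambda>bs. \<bar>f bs\<bar>))\<^sup>2 \<le> mean n (\<lambda>bs. (f bs)\<^sup>2)" by simp
qed

lemma mean_abs_walk_le: "mean n (\<lambda>bs. \<bar>real_of_int (walk bs)\<bar>) \<le> sqrt (real n)"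
  using mean_abs_le[of n "\<lambda>bs. real_of_int (walk bs)"] by (simp add: mean_walk_square)

text \<open>Both sides have the same conditional increments: they grow, by one on average, exactly when the walk is at \<open>1\<close>.\<close>

lemma mean_hits_minus_crossings_square:
  "mean n (\<lambda>bs. (real_of_int (hits bs - crossings bs))\<^sup>2) = mean n (\<lambda>bs. \<bar>real_of_int (walk bs) - 1\<bar>) - 1"
proof (induction n)
  case (Suc n)
  let ?d = "\<lambda>bs. real_of_int (hits bs - crossings bs)"
  \<comment> \<open>An up-step from \<open>0\<close> is both a hit and a crossing, so the difference
    moves only at \<open>1\<close>: up by one on a hit, down by one on a crossing.\<close>
  have hc: "(?d (True # bs))\<^sup>2 + (?d (False # bs))\<^sup>2 = 2 * (?d bs)\<^sup>2 + 2 * of_bool (walk bs = 1)" for bs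
    by (auto simp: power2_eq_square algebra_simps)
  \<comment> \<open>The distance to \<open>1\<close> is a fair walk away from \<open>1\<close>, and
    at \<open>1\<close> either step increases it. The \<open>- 1\<close> in the lemma subtracts its
    initial value.\<close>
  have w: "\<bar>real_of_int (walk (True # bs)) - 1\<bar> + \<bar>real_of_int (walk (False # bs)) - 1\<bar>
      = 2 * \<bar>real_of_int (walk bs) - 1\<bar> + 2 * of_bool (walk bs = 1)" for bs
  proof -
    have "\<bar>walk (True # bs) - 1\<bar> + \<bar>walk (False # bs) - 1\<bar> = 2 * \<bar>walk bs - 1\<bar> + 2 * of_bool (walk bs = 1)"
      by (cases "walk bs = 1"; simp; arith)
    then have "real_of_int (\<bar>walk (True # bs) - 1\<bar> + \<bar>walk (False # bs) - 1\<bar>)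
        = real_of_int (2 * \<bar>walk bs - 1\<bar> + 2 * of_bool (walk bs = 1))" by (rule arg_cong)
    then show ?thesis by simp
  qed
  have "mean (Suc n) (\<lambda>bs. (?d bs)\<^sup>2) = mean n (\<lambda>bs. (?d (True # bs))\<^sup>2 + (?d (False # bs))\<^sup>2) / 2"
    unfolding mean_Suc by simp
  also have "\<dots> = mean n (\<lambda>bs. (?d bs)\<^sup>2) + mean n (\<lambda>bs. of_bool (walk bs = 1))"
    unfolding hc by simp
  also have "\<dots> = mean n (\<lambda>bs. 2 * \<bar>real_of_int (walk bs) - 1\<bar> + 2 * of_bool (walk bs = 1)) / 2 - 1"
    unfolding Suc by simp
  also have "\<dots> = mean (Suc n) (\<lambda>bs. \<bar>real_of_int (walk bs) - 1\<bar>) - 1"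
    unfolding mean_Suc w[symmetric] by simp
  finally show ?case .
qed simp

text \<open>The bound has order n^(1/4), so replacing hits by crossings is negligible on the scale
  \<open>sqrt n\<close>.\<close>

lemma mean_abs_hits_minus_crossings_le:
  "mean n (\<lambda>bs. \<bar>real_of_int (hits bs - crossings bs)\<bar>) \<le> sqrt (sqrt (real n))"
proof -
  have "mean n (\<lambda>bs. \<bar>real_of_int (walk bs) - 1\<bar>) \<le> mean n (\<lambda>bs. \<bar>real_of_int (walk bs)\<bar> + 1)"
    by (rule mean_mono) linarith
  then have "mean n (\<lambda>bs. \<bar>real_of_int (walk bs) - 1\<bar>) - 1 \<le> sqrt (real n)"
    using mean_abs_walk_le[of n] by simp
  then have "sqrt (mean n (\<lambda>bs. (real_of_int (hits bs - crossings bs))\<^sup>2)) \<le> sqrt (sqrt (real n))"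
    unfolding mean_hits_minus_crossings_square by (rule real_sqrt_le_mono)
  with mean_abs_le[of n "\<lambda>bs. real_of_int (hits bs - crossings bs)"] show ?thesis by linarith
qed

section \<open>Exact law of the number of crossings\<close>

definition walk_prob :: "nat \<Rightarrow> int \<Rightarrow> real" where
  "walk_prob n x = mean n (\<lambda>bs. of_bool (walk bs = x))"

lemma walk_prob_Suc: "walk_prob (Suc n) x = (walk_prob n (x - 1) + walk_prob n (x + 1)) / 2"
proof -
  have "(walk bs + 1 = x) = (walk bs = x - 1)" "(walk bs - 1 = x) = (walk bs = x + 1)" for bs
    by auto
  then show ?thesis unfolding walk_prob_def mean_Suc by simp
qed

lemma walk_prob_uminus: "walk_prob n (- x) = walk_prob n x"
proof (induction n arbitrary: x)
  case 0 then show ?case by (simp add: walk_prob_def)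
next
  case (Suc n)
  have "- x - 1 = - (x + 1)" "- x + 1 = - (x - 1)" by auto
  then show ?case unfolding walk_prob_Suc by (simp only: Suc add.commute)
qed

lemma walk_prob_eq_0: "\<bar>x\<bar> > int n \<Longrightarrow> walk_prob n x = 0"
  by (induction n arbitrary: x) (auto simp: walk_prob_Suc, simp add: walk_prob_def)

text \<open>The walk folded at \<open>1 / 2\<close>, i.e. \<open>\<bar>walk - 1 / 2\<bar> - 1 / 2\<close>.\<close>

definition folded :: "bool list \<Rightarrow> int" where
  "folded bs = (if walk bs \<le> 0 then - walk bs else walk bs - 1)"

lemma folded_nonneg: "folded bs \<ge> 0"
  by (simp add: folded_def)

text \<open>The bit \<open>b\<close> is the step away from 1/2. The opposite step moves inward; from
  folded value \<open>0\<close> it traverses the edge between \<open>0\<close> and \<open>1\<close>,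
  which counts one crossing and leaves the folded value at \<open>0\<close>. Both bits being equally
  likely, the side on which the walk stands no longer matters.\<close>

lemma folded_crossings_step:
  obtains b where "folded (b # bs) = folded bs + 1" "crossings (b # bs) = crossings bs"
    "folded ((\<not> b) # bs) = (if folded bs = 0 then 0 else folded bs - 1)"
    "crossings ((\<not> b) # bs) = crossings bs + of_bool (folded bs = 0)"
proof (cases "walk bs \<le> 0")
  case True
  then have "folded bs = - walk bs" by (simp add: folded_def)
  with True show ?thesis by (intro that[of False]) (auto simp: folded_def)
next
  case False
  then have "folded bs = walk bs - 1" by (simp add: folded_def)
  with False show ?thesis by (intro that[of True]) (auto simp: folded_def)
qed

text \<open>Folded walk and crossings evolve jointly like the distance from the running maximum and the
  running maximum of a simple walk; the right-hand side is what the reflection principle gives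
  for the latter pair.\<close>

lemma folded_crossings_prob:
  assumes "y \<ge> 0" "c \<ge> 0"
  shows "mean n (\<lambda>bs. of_bool (folded bs = y \<and> crossings bs = c))
    = walk_prob n (c + y) - walk_prob n (c + y + 2)"
  using assms
proof (induction n arbitrary: y c)
  case 0
  then show ?case by (auto simp: folded_def walk_prob_def)
next
  case (Suc n)
  define p :: "int \<Rightarrow> int \<Rightarrow> bool list \<Rightarrow> real"
    where "p y c bs = of_bool (folded bs = y \<and> crossings bs = c)" for y c bs
  have IH: "mean n (p y c) = walk_prob n (c + y) - walk_prob n (c + y + 2)" if "y \<ge> 0" "c \<ge> 0" for y c
    unfolding p_def using Suc.IH[OF that] .
  have "mean (Suc n) (p y c) = walk_prob (Suc n) (c + y) - walk_prob (Suc n) (c + y + 2)"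
  proof (cases "y = 0")
    case True
    \<comment> \<open>The state \<open>(0, c)\<close> is reached by a crossing from
      \<open>(0, c - 1)\<close> or by an inward step from \<open>(1, c)\<close>.\<close>
    have "p y c (True # bs) + p y c (False # bs) = p 0 (c - 1) bs + p 1 c bs" for bs
    proof -
      obtain b where b: "folded (b # bs) = folded bs + 1" "crossings (b # bs) = crossings bs"
        "folded ((\<not> b) # bs) = (if folded bs = 0 then 0 else folded bs - 1)"
        "crossings ((\<not> b) # bs) = crossings bs + of_bool (folded bs = 0)"
        by (rule folded_crossings_step)
      have "p y c (True # bs) + p y c (False # bs) = p y c (b # bs) + p y c ((\<not> b) # bs)"
        by (cases b) auto
      also have "\<dots> = p 0 (c - 1) bs + p 1 c bs"
        using folded_nonneg[of bs] unfolding p_def b True by auto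
      finally show ?thesis .
    qed
    then have *: "mean (Suc n) (p y c) = (mean n (p 0 (c - 1)) + mean n (p 1 c)) / 2"
      unfolding mean_Suc by simp
    have "mean n (p 0 (c - 1)) = walk_prob n (c - 1) - walk_prob n (c + 1)"
    \<comment> \<open>The induction hypothesis says nothing about the count \<open>-1\<close>. The
      left side is then zero, and the right side vanishes by symmetry of the walk.\<close>
    proof (cases "c = 0")
      case True
      have "crossings bs \<noteq> c - 1" for bs
        using crossings_nonneg[of bs] True by linarith
      then have "p 0 (c - 1) = (\<lambda>_. 0)" by (auto simp: p_def)
      then show ?thesis using True walk_prob_uminus[of n 1] by simp
    next
      case False
      then show ?thesis using IH[of 0 "c - 1"] Suc.prems by (simp add: add.commute)
    qed
    moreover have "mean n (p 1 c) = walk_prob n (c + 1) - walk_prob n (c + 3)"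
      using IH[of 1 c] Suc.prems by (simp add: add.assoc)
    ultimately show ?thesis using True unfolding * walk_prob_Suc
      by (simp add: field_simps)
  next
    case False
    have "p y c (True # bs) + p y c (False # bs) = p (y - 1) c bs + p (y + 1) c bs" for bs
    proof -
      obtain b where b: "folded (b # bs) = folded bs + 1" "crossings (b # bs) = crossings bs"
        "folded ((\<not> b) # bs) = (if folded bs = 0 then 0 else folded bs - 1)"
        "crossings ((\<not> b) # bs) = crossings bs + of_bool (folded bs = 0)"
        by (rule folded_crossings_step)
      have "p y c (True # bs) + p y c (False # bs) = p y c (b # bs) + p y c ((\<not> b) # bs)"
        by (cases b) auto
      also have "\<dots> = p (y - 1) c bs + p (y + 1) c bs"
        using folded_nonneg[of bs] Suc.prems False unfolding p_def b by auto
      finally show ?thesis .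
    qed
    then have *: "mean (Suc n) (p y c) = (mean n (p (y - 1) c) + mean n (p (y + 1) c)) / 2"
      unfolding mean_Suc by simp
    show ?thesis unfolding * walk_prob_Suc using IH[of "y - 1" c] IH[of "y + 1" c] Suc.prems False
      by (simp add: field_simps)
  qed
  then show ?case by (simp only: p_def[abs_def])
qed

lemma folded_le_length: "folded bs \<le> int (length bs)"
proof -
  have "\<bar>walk bs\<bar> \<le> int (length bs)"
    by (induction bs) auto
  then show ?thesis by (auto simp: folded_def)
qed

lemma pmf_map_bits: "pmf (map_pmf f (bits n)) c = mean n (\<lambda>bs. of_bool (f bs = c))"
proof -
  have "(\<lambda>bs. of_bool (f bs = c) :: real) = indicator (f -` {c})"
    by (auto simp: indicator_def)
  then show ?thesis by (simp add: pmf_map)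
qed

text \<open>Summing the joint law over the folded value telescopes with lag two, so two initial
  terms survive. The two final ones lie beyond \<open>n\<close>, out of reach of the walk.\<close>

lemma crossings_prob:
  assumes "c \<ge> 0"
  shows "mean n (\<lambda>bs. of_bool (crossings bs = c)) = walk_prob n c + walk_prob n (c + 1)"
proof -
  let ?q = "\<lambda>i. walk_prob n (c + int i)"
  have tele: "(\<Sum>y\<le>N. ?q y - ?q (y + 2)) = ?q 0 + ?q 1 - ?q (N + 1) - ?q (N + 2)" for N
    by (induction N) (simp_all add: algebra_simps)
  have *: "of_bool (crossings bs = c) = (\<Sum>y\<le>n. of_bool (folded bs = int y \<and> crossings bs = c) :: real)"
    if "length bs = n" for bs
  proof -
    define k where "k = nat (folded bs)"
    have k: "folded bs = int k" "k \<le> n"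
      using folded_nonneg[of bs] folded_le_length[of bs] that by (simp_all add: k_def)
    have "(\<Sum>y\<le>n. of_bool (folded bs = int y \<and> crossings bs = c) :: real)
        = (\<Sum>y\<le>n. if y = k then of_bool (crossings bs = c) else 0)"
      using k by (intro sum.cong) auto
    then show ?thesis using k(2) by simp
  qed
  have "mean n (\<lambda>bs. of_bool (crossings bs = c) :: real)
      = mean n (\<lambda>bs. \<Sum>y\<le>n. of_bool (folded bs = int y \<and> crossings bs = c))"
    by (intro integral_cong_AE) (auto simp: AE_measure_pmf_iff set_bits *)
  also have "\<dots> = (\<Sum>y\<le>n. mean n (\<lambda>bs. of_bool (folded bs = int y \<and> crossings bs = c)))"
    by (rule Bochner_Integration.integral_sum) simp
  also have "\<dots> = (\<Sum>y\<le>n. ?q y - ?q (y + 2))"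
    using assms by (simp only: folded_crossings_prob of_nat_0_le_iff) (simp add: add_ac)
  also have "\<dots> = walk_prob n c + walk_prob n (c + 1)"
    unfolding tele using assms by (simp add: walk_prob_eq_0)
  finally show ?thesis .
qed

text \<open>The walk folded at \<open>- 1 / 2\<close>, i.e. \<open>\<bar>walk + 1 / 2\<bar> - 1 / 2\<close>.\<close>

definition folded_below :: "int \<Rightarrow> int" where
  "folded_below w = (if w \<ge> 0 then w else - w - 1)"

text \<open>The preimages of \<open>c\<close> under \<open>folded_below\<close> are \<open>c\<close>
  and \<open>- (c + 1)\<close>; by symmetry of the walk their probabilities are the two terms of
  \<open>crossings_prob\<close>.\<close>

lemma map_crossings_bits: "map_pmf crossings (bits n) = map_pmf (\<lambda>bs. folded_below (walk bs)) (bits n)"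
proof (rule pmf_eqI)
  fix c
  show "pmf (map_pmf crossings (bits n)) c = pmf (map_pmf (\<lambda>bs. folded_below (walk bs)) (bits n)) c"
  proof (cases "c \<ge> 0")
    case True
    then have "of_bool (folded_below (walk bs) = c) = (of_bool (walk bs = c) + of_bool (walk bs = - (c + 1)) :: real)" for bs
      by (auto simp: folded_below_def)
    then have "mean n (\<lambda>bs. of_bool (folded_below (walk bs) = c)) = walk_prob n c + walk_prob n (- (c + 1))"
      unfolding walk_prob_def by simp
    also have "\<dots> = mean n (\<lambda>bs. of_bool (crossings bs = c))"
      using crossings_prob[OF True] by (simp only: walk_prob_uminus)
    finally show ?thesis by (simp only: pmf_map_bits)
  next
    case False
    then have "crossings bs \<noteq> c" "folded_below (walk bs) \<noteq> c" for bs
      using crossings_nonneg[of bs] by (auto simp: folded_below_def)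
    then show ?thesis by (simp add: pmf_map_bits)
  qed
qed

section \<open>Characteristic functions\<close>

lemma mean_iexp_walk: "mean n (\<lambda>bs. iexp (t * real_of_int (walk bs))) = of_real (cos t ^ n)"
proof (induction n)
  case (Suc n)
  have "iexp (t * real_of_int (walk (True # bs))) + iexp (t * real_of_int (walk (False # bs)))
      = (iexp t + iexp (- t)) * iexp (t * real_of_int (walk bs))" for bs
    by (simp add: algebra_simps flip: exp_add)
  moreover have "iexp t + iexp (- t) = of_real (2 * cos t)"
    by (simp add: complex_eq_iff Re_exp Im_exp)
  ultimately have "mean (Suc n) (\<lambda>bs. iexp (t * real_of_int (walk bs)))
      = (of_real (2 * cos t) * mean n (\<lambda>bs. iexp (t * real_of_int (walk bs)))) /\<^sub>R 2"
    unfolding mean_Suc by (simp only: integral_mult_right_zero)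
  then show ?case unfolding Suc by (simp add: scaleR_conv_of_real)
qed simp

lemma walk_clt:
  "weak_conv_m (\<lambda>n. distr (bits n) borel (\<lambda>bs. real_of_int (walk bs) / sqrt (real n))) std_normal_distribution"
proof (rule levy_continuity)
  fix t :: real
  have "(\<lambda>n. cos (t / sqrt (real n)) ^ n) \<longlonglongrightarrow> exp (- (t * t / 2))"
    by real_asymp
  then have "(\<lambda>n. complex_of_real (cos (t / sqrt (real n)) ^ n)) \<longlonglongrightarrow> of_real (exp (- (t * t / 2)))"
    by (rule tendsto_of_real)
  moreover have "char (distr (bits n) borel (\<lambda>bs. real_of_int (walk bs) / sqrt (real n))) t
      = of_real (cos (t / sqrt (real n)) ^ n)" for n
    unfolding char_def mean_iexp_walk[symmetric] by (subst integral_distr) simp_all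
  ultimately show "(\<lambda>n. char (distr (bits n) borel (\<lambda>bs. real_of_int (walk bs) / sqrt (real n))) t)
      \<longlonglongrightarrow> char std_normal_distribution t"
    by (simp add: char_std_normal_distribution power2_eq_square)
qed (auto intro!: real_dist_normal_dist prob_space.real_distribution_distr measure_pmf.prob_space_axioms)

lemma norm_iexp_diff_le: "cmod (iexp a - iexp b) \<le> \<bar>a - b\<bar>"
proof -
  have "iexp a - iexp b = iexp b * (iexp (a - b) - 1)"
    by (simp add: algebra_simps flip: exp_add)
  then have "cmod (iexp a - iexp b) = cmod (iexp (a - b) - 1)"
    by (simp add: norm_mult)
  also have "\<dots> \<le> \<bar>a - b\<bar>" using iexp_approx1[of "a - b" 0] by simp
  finally show ?thesis .
qed

text \<open>Turns a bound in mean between two random variables into one between characteristic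
  functions; both approximation steps below use this form.\<close>

lemma norm_mean_iexp_diff_le:
  "cmod (mean n (\<lambda>bs. iexp (f bs)) - mean n (\<lambda>bs. iexp (g bs))) \<le> mean n (\<lambda>bs. \<bar>f bs - g bs\<bar>)"
proof -
  have "cmod (mean n (\<lambda>bs. iexp (f bs)) - mean n (\<lambda>bs. iexp (g bs)))
      = cmod (mean n (\<lambda>bs. iexp (f bs) - iexp (g bs)))" by simp
  also have "\<dots> \<le> mean n (\<lambda>bs. cmod (iexp (f bs) - iexp (g bs)))"
    by (rule integral_norm_bound)
  also have "\<dots> \<le> mean n (\<lambda>bs. \<bar>f bs - g bs\<bar>)"
    by (rule mean_mono) (rule norm_iexp_diff_le)
  finally show ?thesis .
qed

text \<open>The characteristic function of the absolute value of a standard normal variable.\<close>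

definition folded_normal_char :: "real \<Rightarrow> complex" where
  "folded_normal_char t = (CLINT x|std_normal_distribution. iexp (t * \<bar>x\<bar>))"

text \<open>Weak convergence applied to the bounded continuous test function
  \<open>iexp (t * |x|)\<close>.\<close>

lemma abs_walk_char:
  "(\<lambda>n. mean n (\<lambda>bs. iexp (t * (\<bar>real_of_int (walk bs)\<bar> / sqrt (real n))))) \<longlonglongrightarrow> folded_normal_char t"
proof -
  let ?D = "\<lambda>n. distr (bits n) borel (\<lambda>bs. real_of_int (walk bs) / sqrt (real n))"
  have "(\<lambda>n. CLINT x|?D n. iexp (t * \<bar>x\<bar>)) \<longlonglongrightarrow> (CLINT x|std_normal_distribution. iexp (t * \<bar>x\<bar>))"
    by (rule weak_conv_imp_integral_bdd_continuous_conv[where B = 1])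
      (auto intro!: real_dist_normal_dist prob_space.real_distribution_distr
        measure_pmf.prob_space_axioms walk_clt continuous_intros)
  moreover have "(CLINT x|?D n. iexp (t * \<bar>x\<bar>)) = mean n (\<lambda>bs. iexp (t * (\<bar>real_of_int (walk bs)\<bar> / sqrt (real n))))" for n
    by (subst integral_distr) simp_all
  ultimately show ?thesis by (simp add: folded_normal_char_def)
qed

text \<open>The scale \<open>s n\<close> is kept apart from the walk length \<open>m n\<close>
  because the walk of a half deck has about n/2 steps but is normalised by the size of the whole
  deck.\<close>

lemma crossings_char:
  assumes m: "filterlim m at_top sequentially"
    and s: "(\<lambda>n. s n * sqrt (real (m n))) \<longlonglongrightarrow> t"
  shows "(\<lambda>n. mean (m n) (\<lambda>bs. iexp (s n * real_of_int (crossings bs)))) \<longlonglongrightarrow> folded_normal_char t"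
proof -
  let ?a = "\<lambda>n. mean (m n) (\<lambda>bs. iexp (s n * real_of_int (crossings bs)))"
  let ?b = "\<lambda>n. mean (m n) (\<lambda>bs. iexp (t * (\<bar>real_of_int (walk bs)\<bar> / sqrt (real (m n)))))"
  have a: "?a n = mean (m n) (\<lambda>bs. iexp (s n * real_of_int (folded_below (walk bs))))" for n
    using arg_cong[OF map_crossings_bits[of "m n"],
        of "\<lambda>p. measure_pmf.expectation p (\<lambda>c. iexp (s n * real_of_int c))"] by simp
  have sqrt_m: "filterlim (\<lambda>n. sqrt (real (m n))) at_top sequentially"
    by (rule filterlim_compose[OF sqrt_at_top filterlim_compose[OF filterlim_real_sequentially m]])
  then have "(\<lambda>n. s n * sqrt (real (m n)) / sqrt (real (m n))) \<longlonglongrightarrow> 0"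
    by (intro tendsto_divide_0[OF s] filterlim_at_top_imp_at_infinity)
  moreover have pos: "\<forall>\<^sub>F n in sequentially. m n > 0"
    by (rule eventually_mono[OF filterlim_at_top[THEN iffD1, OF m, rule_format, of 1]]) simp
  then have "\<forall>\<^sub>F n in sequentially. s n * sqrt (real (m n)) / sqrt (real (m n)) = s n"
    by eventually_elim simp
  ultimately have "s \<longlonglongrightarrow> 0"
    by (rule Lim_transform_eventually)
  then have "(\<lambda>n. \<bar>s n\<bar> + \<bar>s n * sqrt (real (m n)) - t\<bar>) \<longlonglongrightarrow> \<bar>0\<bar> + \<bar>t - t\<bar>"
    by (intro tendsto_intros s)
  then have lim0: "(\<lambda>n. \<bar>s n\<bar> + \<bar>s n * sqrt (real (m n)) - t\<bar>) \<longlonglongrightarrow> 0" by simp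
  have "\<forall>\<^sub>F n in sequentially. cmod (?a n - ?b n) \<le> \<bar>s n\<bar> + \<bar>s n * sqrt (real (m n)) - t\<bar>"
    using pos
  proof eventually_elim
    case (elim n)
    let ?r = "sqrt (real (m n))" and ?w = "\<lambda>bs. real_of_int (walk bs)"
    have r: "?r > 0" using elim by simp
    have "\<bar>s n * real_of_int (folded_below (walk bs)) - t * (\<bar>?w bs\<bar> / ?r)\<bar>
        \<le> \<bar>s n\<bar> + \<bar>s n * ?r - t\<bar> * (\<bar>?w bs\<bar> / ?r)" for bs
    proof -
      \<comment> \<open>Two errors: \<open>d\<close>, bounded by one, from folding at -1/2 instead
        of \<open>0\<close>, and the mismatch of scales times a normalised walk whose mean absolute
        value is at most one.\<close>
      define d where "d = real_of_int (folded_below (walk bs)) - \<bar>?w bs\<bar>"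
      have "\<bar>d\<bar> \<le> 1" by (auto simp: d_def folded_below_def)
      then have "\<bar>s n * d\<bar> \<le> \<bar>s n\<bar>" by (simp add: abs_mult mult_left_le)
      moreover have "s n * real_of_int (folded_below (walk bs)) - t * (\<bar>?w bs\<bar> / ?r)
          = s n * d + (s n * ?r - t) * (\<bar>?w bs\<bar> / ?r)"
        using r by (simp add: d_def field_simps)
      moreover have "\<bar>(s n * ?r - t) * (\<bar>?w bs\<bar> / ?r)\<bar> = \<bar>s n * ?r - t\<bar> * (\<bar>?w bs\<bar> / ?r)"
        using r by (simp add: abs_mult)
      ultimately show ?thesis by linarith
    qed
    then have "mean (m n) (\<lambda>bs. \<bar>s n * real_of_int (folded_below (walk bs)) - t * (\<bar>?w bs\<bar> / ?r)\<bar>)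
        \<le> mean (m n) (\<lambda>bs. \<bar>s n\<bar> + \<bar>s n * ?r - t\<bar> * (\<bar>?w bs\<bar> / ?r))"
      by (rule mean_mono)
    also have "\<dots> = \<bar>s n\<bar> + \<bar>s n * ?r - t\<bar> * (mean (m n) (\<lambda>bs. \<bar>?w bs\<bar>) / ?r)"
      by simp
    also have "\<dots> \<le> \<bar>s n\<bar> + \<bar>s n * ?r - t\<bar>"
      using mean_abs_walk_le[of "m n"] r by (intro add_left_mono mult_left_le) auto
    finally show ?case
      unfolding a by (rule order_trans[OF norm_mean_iexp_diff_le])
  qed
  then have "(\<lambda>n. ?a n - ?b n) \<longlonglongrightarrow> 0"
    by (rule Lim_null_comparison[OF _ lim0])
  moreover have "?b \<longlonglongrightarrow> folded_normal_char t"
    using filterlim_compose[OF abs_walk_char[of t] m] by simp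
  ultimately show ?thesis by (rule Lim_transform[rotated])
qed

section \<open>Shuffling by random bits\<close>

text \<open>\<open>True\<close> takes the next card of the first packet. The result
  \<open>[]\<close> for an exhausted packet is a default; the lemmas below assume that the bit
  counts match the packet lengths.\<close>

fun merge :: "bool list \<Rightarrow> 'a list \<Rightarrow> 'a list \<Rightarrow> 'a list" where
  "merge [] xs ys = xs @ ys"
| "merge (True # bs) xs ys = (case xs of [] \<Rightarrow> [] | x # xs \<Rightarrow> x # merge bs xs ys)"
| "merge (False # bs) xs ys = (case ys of [] \<Rightarrow> [] | y # ys \<Rightarrow> y # merge bs xs ys)"

abbreviation trues :: "bool list \<Rightarrow> nat" where
  "trues bs \<equiv> count_list bs True"

abbreviation falses :: "bool list \<Rightarrow> nat" where
  "falses bs \<equiv> count_list bs False"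

lemma trues_plus_falses: "trues bs + falses bs = length bs"
  by (induction bs) auto

lemma count_list_replicate': "count_list (replicate n x) y = (if x = y then n else 0)"
  by (induction n) auto

lemma merge_nth:
  assumes "trues bs = length xs" "falses bs = length ys" "i < length bs"
  shows "merge bs xs ys ! i
    = (if bs ! i then xs ! trues (take i bs) else ys ! falses (take i bs))"
  using assms
proof (induction bs xs ys arbitrary: i rule: merge.induct)
  case (2 bs xs ys)
  then obtain x xs' where "xs = x # xs'" by (cases xs) auto
  with 2 show ?case by (cases i) auto
next
  case (3 bs xs ys)
  then obtain y ys' where "ys = y # ys'" by (cases ys) auto
  with 3 show ?case by (cases i) auto
qed simp

lemma merge_in_shuffles:
  "\<lbrakk>trues bs = length xs; falses bs = length ys\<rbrakk> \<Longrightarrow> merge bs xs ys \<in> shuffles xs ys"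
proof (induction bs xs ys rule: merge.induct)
  case (2 bs xs ys)
  then obtain x xs' where "xs = x # xs'" by (cases xs) auto
  with 2 show ?case by (auto intro: Cons_in_shuffles_leftI)
next
  case (3 bs xs ys)
  then obtain y ys' where "ys = y # ys'" by (cases ys) auto
  with 3 show ?case by (auto intro: Cons_in_shuffles_rightI)
qed simp

lemma shuffles_imp_merge:
  "zs \<in> shuffles xs ys \<Longrightarrow> \<exists>bs. trues bs = length xs \<and> falses bs = length ys \<and> merge bs xs ys = zs"
proof (induction xs ys arbitrary: zs rule: shuffles.induct)
  case (1 ys)
  have "merge (replicate (length ys) False) [] ys = ys" for ys :: "'a list"
    by (induction ys) auto
  with 1 show ?case by (auto intro!: exI[of _ "replicate (length ys) False"] simp: count_list_replicate')
next
  case (2 xs)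
  have "merge (replicate (length xs) True) xs [] = xs" for xs :: "'a list"
    by (induction xs) auto
  with 2 show ?case by (auto intro!: exI[of _ "replicate (length xs) True"] simp: count_list_replicate')
next
  case (3 x xs y ys)
  then consider zs' where "zs = x # zs'" "zs' \<in> shuffles xs (y # ys)"
    | zs' where "zs = y # zs'" "zs' \<in> shuffles (x # xs) ys"
    by auto
  then show ?case
  proof cases
    case 1
    with 3(1)[of zs'] obtain bs where "trues bs = length xs" "falses bs = length (y # ys)" "merge bs xs (y # ys) = zs'"
      by auto
    with 1 show ?thesis by (intro exI[of _ "True # bs"]) simp
  next
    case 2
    with 3(2)[of zs'] obtain bs where "trues bs = length (x # xs)" "falses bs = length ys" "merge bs (x # xs) ys = zs'"
      by auto
    with 2 show ?thesis by (intro exI[of _ "False # bs"]) simp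
  qed
qed

lemma trues_take_less: "i < length bs \<Longrightarrow> bs ! i \<Longrightarrow> trues (take i bs) < trues bs"
  by (induction bs arbitrary: i) (auto simp: nth_Cons take_Cons split: nat.splits)

lemma falses_take_less: "i < length bs \<Longrightarrow> \<not> bs ! i \<Longrightarrow> falses (take i bs) < falses bs"
  by (induction bs arbitrary: i) (auto simp: nth_Cons take_Cons split: nat.splits)

text \<open>Injective because the packets are disjoint: bit \<open>i\<close> is recovered by asking
  whether the card at index \<open>i\<close> belongs to \<open>xs\<close>.\<close>

lemma bij_betw_merge:
  assumes "distinct (xs @ ys)"
  shows "bij_betw (\<lambda>bs. merge bs xs ys) {bs. trues bs = length xs \<and> falses bs = length ys} (shuffles xs ys)"
proof (rule bij_betw_imageI)
  have bit: "(merge bs xs ys ! i \<in> set xs) = bs ! i"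
    if "trues bs = length xs" "falses bs = length ys" "i < length bs" for bs i
    using that assms trues_take_less[of i bs] falses_take_less[of i bs]
    by (auto simp: merge_nth)
  have len: "length bs = length xs + length ys" if "trues bs = length xs" "falses bs = length ys" for bs
    using trues_plus_falses[of bs] that by simp
  show "inj_on (\<lambda>bs. merge bs xs ys) {bs. trues bs = length xs \<and> falses bs = length ys}"
  proof (rule inj_onI, elim CollectE conjE, rule nth_equalityI)
    fix as bs i
    assume as: "trues as = length xs" "falses as = length ys"
      and bs: "trues bs = length xs" "falses bs = length ys"
      and eq: "merge as xs ys = merge bs xs ys"
    show "length as = length bs" using len[OF as] len[OF bs] by simp
    assume "i < length as"
    then show "as ! i = bs ! i"
      using bit[OF as, of i] bit[OF bs, of i] eq len[OF as] len[OF bs] by simp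
  qed
qed (use merge_in_shuffles shuffles_imp_merge in fastforce)

lemma
  shows finite_trues_falses: "finite {bs. trues bs = k \<and> falses bs = l}"
    and card_trues_falses: "card {bs. trues bs = k \<and> falses bs = l} = (k + l) choose k"
proof -
  let ?xs = "[0..<k]" and ?ys = "[k..<k + l]"
  have bij: "bij_betw (\<lambda>bs. merge bs ?xs ?ys) {bs. trues bs = k \<and> falses bs = l} (shuffles ?xs ?ys)"
    using bij_betw_merge[of ?xs ?ys] by simp
  show "finite {bs. trues bs = k \<and> falses bs = l}"
    using bij_betw_finite[OF bij] by simp
  show "card {bs. trues bs = k \<and> falses bs = l} = (k + l) choose k"
    using bij_betw_same_card[OF bij] by (simp add: card_disjoint_shuffles)
qed

lemma trues_falses_nonempty: "{bs. trues bs = k \<and> falses bs = l} \<noteq> {}"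
  using card_trues_falses[of k l] by fastforce

lemma pmf_bits: "pmf (bits n) bs = of_bool (length bs = n) / 2 ^ n"
proof -
  have "mean n (\<lambda>cs. of_bool (cs = bs)) = (of_bool (length bs = n) / 2 ^ n :: real)"
  proof (induction n arbitrary: bs)
    case (Suc n)
    show ?case
    proof (cases bs)
      case (Cons b bs')
      with Suc[of bs'] show ?thesis by (cases b) (simp_all add: mean_Suc)
    qed (simp add: mean_Suc)
  qed auto
  moreover have "mean n (\<lambda>cs. of_bool (cs = bs)) = pmf (bits n) bs"
    by (subst integral_measure_pmf_real[of "{bs}"]) auto
  ultimately show ?thesis by simp
qed

text \<open>The binomial weight of \<open>k\<close> cancels the number of arrangements of
  \<open>k\<close> true bits, leaving 1/2^n for each list.\<close>

lemma bits_eq_bind_binomial: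
  "bits n = binomial_pmf n (1 / 2) \<bind> (\<lambda>k. pmf_of_set {bs. trues bs = k \<and> falses bs = n - k})"
proof (rule pmf_eqI)
  fix bs
  let ?B = "\<lambda>k. {bs. trues bs = k \<and> falses bs = n - k}"
  have "pmf (binomial_pmf n (1 / 2) \<bind> (\<lambda>k. pmf_of_set (?B k))) bs
      = (\<Sum>k\<le>n. pmf (pmf_of_set (?B k)) bs * pmf (binomial_pmf n (1 / 2)) k)"
    unfolding pmf_bind by (rule integral_measure_pmf_real) auto
  also have "\<dots> = (\<Sum>k\<le>n. if k = trues bs then of_bool (length bs = n) / 2 ^ n else 0)"
  proof (rule sum.cong)
    fix k assume "k \<in> {..n}"
    then have "bs \<in> ?B k \<longleftrightarrow> k = trues bs \<and> length bs = n" "(n choose k) \<noteq> 0"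
      using trues_plus_falses[of bs] by auto
    moreover have "(1 / 2 :: real) ^ k * (1 / 2) ^ (n - k) = 1 / 2 ^ n"
      using \<open>k \<in> {..n}\<close> by (simp add: power_one_over flip: power_add)
    ultimately show "pmf (pmf_of_set (?B k)) bs * pmf (binomial_pmf n (1 / 2)) k
        = (if k = trues bs then of_bool (length bs = n) / 2 ^ n else 0)"
      using \<open>k \<in> {..n}\<close>
      by (simp add: pmf_of_set[OF trues_falses_nonempty finite_trues_falses] card_trues_falses indicator_def mult.assoc)
  qed simp
  also have "\<dots> = pmf (bits n) bs"
    using trues_plus_falses[of bs] by (auto simp: pmf_bits)
  finally show "pmf (bits n) bs = pmf (binomial_pmf n (1 / 2) \<bind> (\<lambda>k. pmf_of_set (?B k))) bs" by simp
qed

definition shuffled_deck :: "bool list \<Rightarrow> nat list" where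
  "shuffled_deck bs = merge bs [1..<trues bs + 1] [trues bs + 1..<length bs + 1]"

text \<open>The cut is the number of true bits. Given the cut, both sides are uniform over the
  interleavings, by \<open>riffle_eq_pmf_of_set\<close> and \<open>bij_betw_merge\<close>.\<close>

lemma gsr_shuffle_eq_map_bits: "gsr_shuffle n = map_pmf shuffled_deck (bits n)"
proof -
  have "riffle [1..<k + 1] [k + 1..<n + 1]
      = map_pmf shuffled_deck (pmf_of_set {bs. trues bs = k \<and> falses bs = n - k})"
    if "k \<in> set_pmf (binomial_pmf n (1 / 2))" for k
  proof -
    let ?B = "{bs. trues bs = k \<and> falses bs = n - k}" and ?xs = "[1..<k + 1]" and ?ys = "[k + 1..<n + 1]"
    have k: "k \<le> n" using that by simp
    have "riffle ?xs ?ys = pmf_of_set (shuffles ?xs ?ys)"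
      by (rule riffle_eq_pmf_of_set) auto
    also have "\<dots> = map_pmf (\<lambda>bs. merge bs ?xs ?ys) (pmf_of_set ?B)"
    proof (rule map_pmf_of_set_bij_betw[symmetric])
      have "distinct (?xs @ ?ys)" by auto
      from bij_betw_merge[OF this] show "bij_betw (\<lambda>bs. merge bs ?xs ?ys) ?B (shuffles ?xs ?ys)"
        by (simp del: upt_Suc)
    qed (fact trues_falses_nonempty finite_trues_falses)+
    also have "\<dots> = map_pmf shuffled_deck (pmf_of_set ?B)"
    proof (rule map_pmf_cong)
      fix bs assume "bs \<in> set_pmf (pmf_of_set ?B)"
      then have "trues bs = k" "length bs = n"
        using k finite_trues_falses trues_falses_nonempty trues_plus_falses[of bs] by auto
      then show "merge bs ?xs ?ys = shuffled_deck bs" by (simp add: shuffled_deck_def)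
    qed simp
    finally show ?thesis .
  qed
  then show ?thesis unfolding gsr_shuffle_def bits_eq_bind_binomial map_bind_pmf
    by (intro bind_pmf_cong) auto
qed


section \<open>Correct guesses expressed by hits\<close>

lemma card_at_shuffled_deck:
  assumes "j \<in> {1..length bs}"
  shows "card_at (shuffled_deck bs) j
    = (if bs ! (j - 1) then trues (take j bs) else trues bs + falses (take j bs))"
proof -
  obtain i where j: "j = Suc i" and i: "i < length bs" using assms by (cases j) auto
  have "shuffled_deck bs ! i = (if bs ! i then [1..<trues bs + 1] ! trues (take i bs)
      else [trues bs + 1..<length bs + 1] ! falses (take i bs))"
    unfolding shuffled_deck_def using i trues_plus_falses[of bs] by (intro merge_nth) auto
  moreover have "take j bs = take i bs @ [bs ! i]"
    unfolding j by (rule take_Suc_conv_app_nth) fact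
  ultimately show ?thesis
    using i trues_take_less[OF i] falses_take_less[OF i] trues_plus_falses[of bs]
    by (auto simp: card_at_def j simp del: upt_Suc)
qed

lemma walk_eq: "walk bs = 2 * int (trues bs) - int (length bs)"
  by (induction bs) auto

text \<open>The truncated \<open>j div 2\<close> matches hits of both kinds: by parity the walk can stand at \<open>0\<close> only
  before an odd step \<open>j\<close>, and at \<open>1\<close> only before an even one.\<close>

lemma hits_rev:
  "hits (rev bs) = int (card {j \<in> {1..length bs}. bs ! (j - 1) \<and> trues (take j bs) = j div 2 + 1})"
proof (induction bs rule: rev_induct)
  case (snoc b bs)
  let ?n = "length bs"
  let ?A = "\<lambda>bs n. {j \<in> {1..n}. bs ! (j - 1) \<and> trues (take j bs) = j div 2 + 1}"
  have "?A (bs @ [b]) ?n = ?A bs ?n"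
    by (auto simp: nth_append)
  moreover have "{j \<in> {1..Suc ?n}. P j} = {j \<in> {1..?n}. P j} \<union> (if P (Suc ?n) then {Suc ?n} else {})" for P
    by (auto simp: le_Suc_eq)
  then have "?A (bs @ [b]) (Suc ?n) = ?A (bs @ [b]) ?n
      \<union> (if b \<and> trues bs + 1 = Suc ?n div 2 + 1 then {Suc ?n} else {})"
    by auto
  ultimately have "card (?A (bs @ [b]) (Suc ?n)) = card (?A bs ?n) + of_bool (b \<and> trues bs + 1 = Suc ?n div 2 + 1)"
    by auto
  moreover have "(walk (rev bs) \<in> {0, 1}) = (trues bs + 1 = Suc ?n div 2 + 1)"
    unfolding walk_eq by simp presburger
  ultimately show ?case using snoc by simp
qed simp

lemma trues_map_Not: "trues (map Not bs) = falses bs"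
  by (induction bs) auto

text \<open>The last entry of \<open>drop h bs\<close> is the bottom card and the head is the newest
  step, so without any \<open>rev\<close> the walk already runs upward from the bottom. The claim is
  \<open>hits_rev\<close> with positions mirrored by \<open>j = n + 1 - i\<close>.\<close>

lemma hits_map_Not_drop:
  assumes "h \<le> length bs"
  shows "hits (map Not (drop h bs)) = int (card {j \<in> {h<..length bs}. \<not> bs ! (j - 1)
    \<and> falses (drop (j - 1) bs) = (length bs - j + 1) div 2 + 1})"
proof -
  let ?v = "rev (map Not (drop h bs))" and ?n = "length bs"
  let ?Q = "\<lambda>i. ?v ! (i - 1) \<and> trues (take i ?v) = i div 2 + 1"
  let ?R = "\<lambda>j. \<not> bs ! (j - 1) \<and> falses (drop (j - 1) bs) = (?n - j + 1) div 2 + 1"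
  have QR: "?Q i \<longleftrightarrow> ?R (?n + 1 - i)" if "i \<in> {1..?n - h}" for i
  proof -
    have "?n + 1 - i - 1 = ?n - i" "?n - (?n + 1 - i) + 1 = i" using that by auto
    moreover have "?v ! (i - 1) = (\<not> bs ! (?n - i))" "trues (take i ?v) = falses (drop (?n - i) bs)"
      using that assms by (auto simp: rev_nth take_rev drop_map trues_map_Not)
    ultimately show ?thesis by simp
  qed
  have RQ: "?R j \<longleftrightarrow> ?Q (?n + 1 - j)" if "j \<in> {h<..?n}" for j
  proof -
    have "?n + 1 - (?n + 1 - j) = j" "?n + 1 - j \<in> {1..?n - h}" using that by auto
    with QR[of "?n + 1 - j"] show ?thesis by simp
  qed
  have "bij_betw (\<lambda>i. ?n + 1 - i) {i \<in> {1..length ?v}. ?Q i} {j \<in> {h<..?n}. ?R j}"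
  proof (rule bij_betw_byWitness[where f' = "\<lambda>j. ?n + 1 - j"])
    show "(\<lambda>i. ?n + 1 - i) ` {i \<in> {1..length ?v}. ?Q i} \<subseteq> {j \<in> {h<..?n}. ?R j}"
      using QR assms by (intro image_subsetI CollectI conjI; elim CollectE conjE) auto
    show "(\<lambda>j. ?n + 1 - j) ` {j \<in> {h<..?n}. ?R j} \<subseteq> {i \<in> {1..length ?v}. ?Q i}"
      using RQ assms by (intro image_subsetI CollectI conjI; elim CollectE conjE) auto
  qed auto
  from bij_betw_same_card[OF this] show ?thesis using hits_rev[of ?v] by simp
qed

text \<open>In the top half, correct guesses of first-packet cards are hits. A second-packet card at
  position \<open>j\<close> has label at least \<open>j\<close>, so a correct guess there forces
  \<open>j <= 2\<close>. In the bottom half the packets swap roles and the exceptions satisfy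
  \<open>j >= n - 1\<close>. These four positions form \<open>?E\<close>.\<close>

lemma correct_guesses_shuffled_deck:
  assumes n: "length bs = n" and h: "h = nat \<lceil>real n / 2\<rceil>"
  shows "\<bar>int (correct_guesses n (shuffled_deck bs)) - (hits (rev (take h bs)) + hits (map Not (drop h bs)))\<bar> \<le> 4"
proof -
  have hn: "h \<le> n" unfolding h by linarith
  let ?G = "{j \<in> {1..n}. card_at (shuffled_deck bs) j = guess n j}"
  let ?T = "{j \<in> {1..h}. bs ! (j - 1) \<and> trues (take j bs) = j div 2 + 1}"
  let ?B = "{j \<in> {h<..n}. \<not> bs ! (j - 1) \<and> falses (drop (j - 1) bs) = (n - j + 1) div 2 + 1}"
  let ?E = "{1, 2, n - 1, n}"
  have top: "j \<in> ?G \<longleftrightarrow> j \<in> ?T \<or> (\<not> bs ! (j - 1) \<and> trues bs + falses (take j bs) = j div 2 + 1)"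
    if "j \<in> {1..h}" for j
  proof -
    have "guess n j = j div 2 + 1" using that by (simp add: guess_def h)
    then show ?thesis using that hn n card_at_shuffled_deck[of j bs] by auto
  qed
  have top_error: "j \<in> ?E" if "j \<in> {1..h}" "trues bs + falses (take j bs) = j div 2 + 1" for j
  proof -
    have "trues (take j bs) \<le> trues bs"
      using count_list_append[of "take j bs" "drop j bs" True] by simp
    moreover have "trues (take j bs) + falses (take j bs) = j"
      using that hn n by (simp add: trues_plus_falses)
    ultimately have "j \<le> j div 2 + 1" using that by linarith
    then have "j \<le> 2" by linarith
    with that show ?thesis by auto
  qed
  have bottom: "j \<in> ?G \<longleftrightarrow> j \<in> ?B \<or> (bs ! (j - 1) \<and> trues (take j bs) = n - (n - j + 1) div 2)"
    if "j \<in> {h<..n}" for j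
  proof -
    have jn: "j - 1 < length bs" "j \<ge> 1" using that n by auto
    define q where "q = (n - j + 1) div 2"
    have card: "card_at (shuffled_deck bs) j
        = (if bs ! (j - 1) then trues (take j bs) else trues bs + falses (take j bs))"
      using that n by (intro card_at_shuffled_deck) simp
    have g: "guess n j = n - q" using that by (simp add: guess_def h q_def)
    show ?thesis
    proof (cases "bs ! (j - 1)")
      case True
      then show ?thesis using that card g by (simp add: q_def)
    next
      case False
      \<comment> \<open>The label of a second-packet card is \<open>n\<close> minus the number of
        second-packet cards below it. Dropping only \<open>j - 1\<close> entries counts the card
        itself as well, hence the \<open>+ 1\<close> in the guess condition of
        \<open>?B\<close>.\<close>
      have sum: "n = trues bs + falses (take j bs) + falses (drop j bs)"
        using trues_plus_falses[of bs] count_list_append[of "take j bs" "drop j bs" False] n by simp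
      have "drop (j - 1) bs = bs ! (j - 1) # drop j bs"
        using Cons_nth_drop_Suc[OF jn(1)] jn(2) by simp
      with False have drop: "falses (drop (j - 1) bs) = falses (drop j bs) + 1" by simp
      have "q \<le> n" unfolding q_def by linarith
      then have "trues bs + falses (take j bs) = n - q \<longleftrightarrow> falses (drop j bs) = q"
        using sum by linarith
      moreover have "j \<in> ?G \<longleftrightarrow> trues bs + falses (take j bs) = n - q"
        using that False card g by simp
      moreover have "j \<in> ?B \<longleftrightarrow> falses (drop j bs) = q"
        using that False drop by (simp add: q_def)
      ultimately show ?thesis using False by blast
    qed
  qed
  have bottom_error: "j \<in> ?E" if "j \<in> {h<..n}" "trues (take j bs) = n - (n - j + 1) div 2" for j
  proof -
    have "trues (take j bs) \<le> j"
      using trues_plus_falses[of "take j bs"] that n by simp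
    with that have "n - (n - j + 1) div 2 \<le> j" by simp
    then have "n \<le> j + 1" using that by auto
    with that show ?thesis by auto
  qed
  have fin: "finite ?T" "finite ?B" "?T \<inter> ?B = {}" by auto
  have G: "j \<in> ?G \<Longrightarrow> j \<in> {1..h} \<or> j \<in> {h<..n}" "j \<in> {1..h} \<or> j \<in> {h<..n} \<Longrightarrow> j \<in> {1..n}" for j
    using hn by auto
  have "?T \<union> ?B \<subseteq> ?G"
    using top bottom by blast
  then have "card (?T \<union> ?B) \<le> card ?G"
    by (intro card_mono) simp_all
  moreover have "?G \<subseteq> (?T \<union> ?B) \<union> ?E"
    using top bottom top_error bottom_error G by blast
  then have "card ?G \<le> card ((?T \<union> ?B) \<union> ?E)"
    by (intro card_mono) simp_all
  moreover note card_Un_le[of "?T \<union> ?B" ?E]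
  moreover note card_Un_disjoint[OF fin]
  moreover have "card ?E \<le> 4" by (simp add: card_insert_if)
  moreover have "hits (rev (take h bs)) = int (card ?T)"
  proof -
    have "?T = {j \<in> {1..length (take h bs)}. take h bs ! (j - 1) \<and> trues (take j (take h bs)) = j div 2 + 1}"
      using hn n by (auto simp: min_absorb1)
    then show ?thesis by (simp only: hits_rev)
  qed
  moreover have "hits (map Not (drop h bs)) = int (card ?B)"
    using hits_map_Not_drop[of h bs] hn n by simp
  ultimately show ?thesis unfolding correct_guesses_def by linarith
qed

section \<open>The half-normal limit\<close>

lemma half_normal_density_eq: "half_normal_density x = indicator {0..} x * (2 / sqrt pi * exp (- x\<^sup>2))"
  by (simp add: half_normal_density_def indicator_def)

lemma borel_measurable_half_normal [measurable]: "half_normal_density \<in> borel_measurable borel"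
  unfolding half_normal_density_eq[abs_def] by measurable

lemma half_normal_density_nonneg: "0 \<le> half_normal_density x"
  by (simp add: half_normal_density_def)

text \<open>The integrand is even, so the integral is twice that over the half-line; the
  substitution \<open>x = sqrt 2 * x'\<close> then yields the half-normal density.\<close>

lemma folded_normal_char_eq:
  "folded_normal_char (t * sqrt (1 / 2)) = (CLINT x|lborel. half_normal_density x *\<^sub>R iexp (t * x))"
proof -
  let ?\<tau> = "t * sqrt (1 / 2)"
  let ?f = "\<lambda>x. std_normal_density x *\<^sub>R iexp (?\<tau> * \<bar>x\<bar>)"
  have int: "integrable lborel ?f"
    by (rule Bochner_Integration.integrable_bound[of _ std_normal_density]) auto
  have "has_bochner_integral lborel (\<lambda>x. indicator {0..} x *\<^sub>R ?f x) (CLINT x|lborel. indicator {0..} x *\<^sub>R ?f x)"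
    by (intro has_bochner_integral_integrable integrable_mult_indicator int) simp
  then have "has_bochner_integral lborel ?f (2 *\<^sub>R (CLINT x|lborel. indicator {0..} x *\<^sub>R ?f x))"
    by (rule has_bochner_integral_even_function) (simp add: std_normal_density_def)
  then have "(CLINT x|lborel. ?f x) = 2 *\<^sub>R (CLINT x|lborel. indicator {0..} x *\<^sub>R ?f x)"
    by (rule has_bochner_integral_integral_eq)
  also have "(CLINT x|lborel. indicator {0..} x *\<^sub>R ?f x)
      = \<bar>sqrt 2\<bar> *\<^sub>R (CLINT x|lborel. indicator {0..} (0 + sqrt 2 * x) *\<^sub>R ?f (0 + sqrt 2 * x))"
    by (rule lborel_integral_real_affine) simp
  also have "2 *\<^sub>R (\<bar>sqrt 2\<bar> *\<^sub>R (CLINT x|lborel. indicator {0..} (0 + sqrt 2 * x) *\<^sub>R ?f (0 + sqrt 2 * x)))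
      = (CLINT x|lborel. (2 * sqrt 2) *\<^sub>R (indicator {0..} (0 + sqrt 2 * x) *\<^sub>R ?f (0 + sqrt 2 * x)))"
    by (simp only: scaleR_scaleR[of _ _ "integral\<^sup>L _ _"] integral_scaleR_right abs_of_nonneg real_sqrt_ge_zero zero_le_numeral)
  also have "\<dots> = (CLINT x|lborel. half_normal_density x *\<^sub>R iexp (t * x))"
  proof (rule Bochner_Integration.integral_cong)
    fix x :: real
    have "2 * sqrt 2 * std_normal_density (sqrt 2 * x) = 2 / sqrt pi * exp (- x\<^sup>2)"
      by (simp add: std_normal_density_def real_sqrt_mult power_mult_distrib)
    moreover have arg: "?\<tau> * \<bar>0 + sqrt 2 * x\<bar> = t * x" if "x \<ge> 0"
      using that by (simp add: abs_mult real_sqrt_divide)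
    ultimately show "(2 * sqrt 2) *\<^sub>R (indicator {0..} (0 + sqrt 2 * x) *\<^sub>R ?f (0 + sqrt 2 * x))
        = half_normal_density x *\<^sub>R iexp (t * x)"
    proof (cases "x \<ge> 0")
      case True
      then show ?thesis unfolding arg[OF True]
        using \<open>2 * sqrt 2 * std_normal_density (sqrt 2 * x) = _\<close> by (simp add: half_normal_density_eq)
    qed (simp add: half_normal_density_eq zero_le_mult_iff)
  qed simp
  finally show ?thesis
    by (simp add: folded_normal_char_def integral_density)
qed

lemma char_half_normal:
  assumes "distributed M lborel H (\<lambda>x. ennreal (half_normal_density x))"
  shows "char (distr M borel H) t = folded_normal_char (t * sqrt (1 / 2))"
proof -
  have "distr M borel H = distr M lborel H" by (rule distr_cong) auto
  also have "\<dots> = density lborel half_normal_density"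
    using assms by (rule distributed_distr_eq_density)
  finally show ?thesis
    by (simp add: char_def folded_normal_char_eq integral_density half_normal_density_nonneg)
qed

text \<open>Total mass one and equal tails on both sides.\<close>

lemma std_normal_symmetric_interval:
  "(\<integral>\<^sup>+u. ennreal (indicator {- x..x} u * std_normal_density u) \<partial>lborel) = ennreal (2 * std_normal_cdf x - 1)"
  if "x \<ge> 0"
proof -
  let ?I = "\<lambda>A. LINT u|lborel. indicator A u * std_normal_density u"
  have int: "integrable lborel (\<lambda>u. indicator A u * std_normal_density u)" if "A \<in> sets borel" for A
    using integrable_mult_indicator[of A lborel std_normal_density] that by simp
  have "?I {..x} = ?I {..<- x} + ?I {- x..x}"
    using \<open>x \<ge> 0\<close> by (subst Bochner_Integration.integral_add[symmetric, OF int int])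
      (auto intro!: Bochner_Integration.integral_cong simp: indicator_def)
  moreover have "?I UNIV = ?I {..x} + ?I {x<..}"
    by (subst Bochner_Integration.integral_add[symmetric, OF int int], simp, simp,
        rule Bochner_Integration.integral_cong) (auto simp: indicator_def)
  moreover have "?I {..<- x} = ?I {x<..}"
    by (subst lborel_integral_real_affine[where c = "-1" and t = 0])
      (auto intro!: Bochner_Integration.integral_cong simp: indicator_def std_normal_density_def)
  ultimately have "?I {- x..x} = 2 * std_normal_cdf x - 1"
    by (simp add: std_normal_cdf_def set_lebesgue_integral_def)
  then show ?thesis
    using nn_integral_eq_integral[OF int, of "{- x..x}"] by simp
qed

lemma half_normal_convolution:
  "(\<integral>\<^sup>+y. ennreal (half_normal_density (x - y)) * ennreal (half_normal_density y) \<partial>lborel)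
    = ennreal (limit_density x)"
proof (cases "x \<ge> 0")
  case False
  then have "(\<lambda>y. ennreal (half_normal_density (x - y)) * ennreal (half_normal_density y)) = (\<lambda>_. 0)"
    by (auto simp: half_normal_density_def)
  then show ?thesis using False by (simp add: limit_density_def)
next
  case True
  let ?g = "\<lambda>y. half_normal_density (x - y) * half_normal_density y"
  have "(\<integral>\<^sup>+y. ennreal (half_normal_density (x - y)) * ennreal (half_normal_density y) \<partial>lborel)
      = (\<integral>\<^sup>+y. ennreal (?g y) \<partial>lborel)"
    by (simp add: ennreal_mult half_normal_density_nonneg)
  \<comment> \<open>With \<open>y = (x + u) / 2\<close> the exponent \<open>(x - y)^2 + y^2\<close>
    becomes \<open>(x^2 + u^2) / 2\<close>, which separates the variables, and
    \<open>0 <= y <= x\<close> becomes \<open>|u| <= x\<close>. The constant 4/pi equals 8/(2 pi),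
    and the Jacobian 1/2 reduces the 8 to 4.\<close>
  also have "\<dots> = ennreal \<bar>1 / 2\<bar> * (\<integral>\<^sup>+u. ennreal (?g (x / 2 + 1 / 2 * u)) \<partial>lborel)"
    by (rule nn_integral_real_affine) auto
  also have "(\<integral>\<^sup>+u. ennreal (?g (x / 2 + 1 / 2 * u)) \<partial>lborel)
      = (\<integral>\<^sup>+u. ennreal (8 * std_normal_density x) * ennreal (indicator {- x..x} u * std_normal_density u) \<partial>lborel)"
  proof (rule nn_integral_cong)
    fix u :: real
    define y where "y = x / 2 + 1 / 2 * u"
    have "exp (- (x - y)\<^sup>2) * exp (- y\<^sup>2) = exp (- x\<^sup>2 / 2) * exp (- u\<^sup>2 / 2)"
      unfolding exp_add[symmetric] y_def by (simp add: power2_eq_square field_simps)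
    moreover have "(0 \<le> x - y \<and> 0 \<le> y) = (u \<in> {- x..x})" by (auto simp: y_def)
    moreover have "?g y = of_bool (0 \<le> x - y \<and> 0 \<le> y) * (4 / pi * (exp (- (x - y)\<^sup>2) * exp (- y\<^sup>2)))"
      by (simp add: half_normal_density_def)
    ultimately have "?g y = indicator {- x..x} u * (4 / pi * (exp (- x\<^sup>2 / 2) * exp (- u\<^sup>2 / 2)))"
      by (simp add: indicator_def)
    also have "\<dots> = 8 * std_normal_density x * (indicator {- x..x} u * std_normal_density u)"
      by (simp add: std_normal_density_def)
    finally show "ennreal (?g (x / 2 + 1 / 2 * u))
        = ennreal (8 * std_normal_density x) * ennreal (indicator {- x..x} u * std_normal_density u)"
      by (simp add: y_def ennreal_mult)
  qed
  also have "\<dots> = ennreal (8 * std_normal_density x) * ennreal (2 * std_normal_cdf x - 1)"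
    by (subst nn_integral_cmult) (auto simp: std_normal_symmetric_interval[OF True])
  also have "ennreal \<bar>1 / 2\<bar> * \<dots> = ennreal (\<bar>1 / 2\<bar> * (8 * std_normal_density x * (2 * std_normal_cdf x - 1)))"
    by (simp only: ennreal_mult' abs_ge_zero mult_nonneg_nonneg zero_le_numeral normal_density_nonneg)
  also have "\<dots> = ennreal (limit_density x)"
    using True by (simp add: limit_density_def mult.assoc)
  finally show ?thesis .
qed

section \<open>Convergence of the number of correct guesses\<close>

text \<open>Independence of the two blocks of bits. \<open>F\<close> is generalised because the
  induction replaces it by its sum over the first bit.\<close>

lemma mean_take_drop:
  fixes F G :: "bool list \<Rightarrow> 'b::{real_normed_field, banach, second_countable_topology}"
  shows "mean (m + n) (\<lambda>bs. F (take m bs) * G (drop m bs)) = mean m F * mean n G"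
proof (induction m arbitrary: F)
  case (Suc m)
  have "mean (Suc m + n) (\<lambda>bs. F (take (Suc m) bs) * G (drop (Suc m) bs))
      = mean (m + n) (\<lambda>bs. (F (True # take m bs) + F (False # take m bs)) * G (drop m bs)) /\<^sub>R 2"
    by (simp add: mean_Suc distrib_right)
  also have "\<dots> = mean m (\<lambda>bs. F (True # bs) + F (False # bs)) * mean n G /\<^sub>R 2"
    by (subst Suc) simp
  finally show ?case by (simp add: mean_Suc)
qed simp

lemma mean_rev: "mean n (\<lambda>bs. F (rev bs)) = mean n F"
proof -
  have "pmf (map_pmf rev (bits n)) bs = pmf (bits n) bs" for bs
    using pmf_map_inj'[of rev "bits n" "rev bs"] by (simp add: pmf_bits inj_on_def)
  then have "map_pmf rev (bits n) = bits n" by (rule pmf_eqI)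
  then have "mean n F = measure_pmf.expectation (map_pmf rev (bits n)) F" by simp
  then show ?thesis by simp
qed

lemma mean_map_Not: "mean n (\<lambda>bs. F (map Not bs)) = mean n F"
proof (induction n arbitrary: F)
  case (Suc n)
  show ?case by (simp add: mean_Suc add.commute Suc[of "\<lambda>bs. F (_ # bs)"] flip: Suc[of "\<lambda>bs. F (True # bs) + F (False # bs)"])
qed simp

text \<open>The product is exactly the characteristic function of the summed crossings of the two
  independent halves. The error collects the four exceptional positions and one hits-crossings
  discrepancy per half; it is of order n^(-1/4) for fixed \<open>t\<close>.\<close>

lemma correct_guesses_char_diff:
  assumes h: "h = nat \<lceil>real n / 2\<rceil>"
  shows "cmod (char (distr (measure_pmf (gsr_shuffle n)) borel
        (\<lambda>deck. real (correct_guesses n deck) / sqrt (real n))) t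
      - mean h (\<lambda>bs. iexp (t / sqrt (real n) * real_of_int (crossings bs)))
        * mean (n - h) (\<lambda>bs. iexp (t / sqrt (real n) * real_of_int (crossings bs))))
    \<le> \<bar>t\<bar> / sqrt (real n) * (4 + 2 * sqrt (sqrt (real n)))"
proof -
  let ?s = "t / sqrt (real n)"
  let ?X = "\<lambda>bs. real (correct_guesses n (shuffled_deck bs))"
  let ?e = "\<lambda>bs. iexp (?s * real_of_int (crossings bs))"
  let ?u = "\<lambda>bs. rev (take h bs)" and ?v = "\<lambda>bs. map Not (drop h bs)"
  let ?d = "\<lambda>bs. \<bar>real_of_int (hits bs - crossings bs)\<bar>"
  have n: "h + (n - h) = n" unfolding h by linarith
  have split: "mean n (\<lambda>bs. F (?u bs) * G (?v bs)) = mean h F * mean (n - h) G"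
    for F G :: "bool list \<Rightarrow> 'b::{real_normed_field, banach, second_countable_topology}"
    using mean_take_drop[of h "n - h" "\<lambda>bs. F (rev bs)" "\<lambda>bs. G (map Not bs)"]
    unfolding n mean_rev mean_map_Not .
  have "char (distr (measure_pmf (gsr_shuffle n)) borel
      (\<lambda>deck. real (correct_guesses n deck) / sqrt (real n))) t = mean n (\<lambda>bs. iexp (?s * ?X bs))"
    unfolding char_def by (subst integral_distr) (simp_all add: gsr_shuffle_eq_map_bits)
  moreover have "mean h ?e * mean (n - h) ?e
      = mean n (\<lambda>bs. iexp (?s * real_of_int (crossings (?u bs) + crossings (?v bs))))"
    unfolding split[symmetric] by (simp add: exp_add[symmetric] algebra_simps add_divide_distrib)
  ultimately have "cmod (char (distr (measure_pmf (gsr_shuffle n)) borel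
        (\<lambda>deck. real (correct_guesses n deck) / sqrt (real n))) t - mean h ?e * mean (n - h) ?e)
      \<le> mean n (\<lambda>bs. \<bar>?s * ?X bs - ?s * real_of_int (crossings (?u bs) + crossings (?v bs))\<bar>)"
    by (simp only: norm_mean_iexp_diff_le)
  also have "\<dots> \<le> mean n (\<lambda>bs. \<bar>?s\<bar> * (4 + (?d (?u bs) + ?d (?v bs))))"
  proof (rule mean_mono)
    fix bs :: "bool list" assume "length bs = n"
    from correct_guesses_shuffled_deck[OF this h]
    have "\<bar>?X bs - real_of_int (crossings (?u bs) + crossings (?v bs))\<bar> \<le> 4 + (?d (?u bs) + ?d (?v bs))"
      by linarith
    then have "\<bar>?s\<bar> * \<bar>?X bs - real_of_int (crossings (?u bs) + crossings (?v bs))\<bar>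
        \<le> \<bar>?s\<bar> * (4 + (?d (?u bs) + ?d (?v bs)))"
      by (rule mult_left_mono) simp
    then show "\<bar>?s * ?X bs - ?s * real_of_int (crossings (?u bs) + crossings (?v bs))\<bar>
        \<le> \<bar>?s\<bar> * (4 + (?d (?u bs) + ?d (?v bs)))"
      by (simp only: right_diff_distrib[symmetric] abs_mult)
  qed
  also have "\<dots> = \<bar>?s\<bar> * (4 + (mean n (\<lambda>bs. ?d (?u bs)) + mean n (\<lambda>bs. ?d (?v bs))))"
    by (simp del: of_int_diff)
  also have "mean n (\<lambda>bs. ?d (?u bs)) = mean h ?d"
    \<comment> \<open>A constant second factor leaves the marginal law of one half.\<close>
    using split[of ?d "\<lambda>_. 1"] by simp
  also have "mean n (\<lambda>bs. ?d (?v bs)) = mean (n - h) ?d"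
    using split[of "\<lambda>_. 1" ?d] by simp
  also have "\<bar>?s\<bar> * (4 + (mean h ?d + mean (n - h) ?d)) \<le> \<bar>?s\<bar> * (4 + 2 * sqrt (sqrt (real n)))"
  proof (rule mult_left_mono)
    have "mean m ?d \<le> sqrt (sqrt (real n))" if "m \<le> n" for m
      using that by (intro order_trans[OF mean_abs_hits_minus_crossings_le]) simp
    from this[of h] this[of "n - h"] n show "4 + (mean h ?d + mean (n - h) ?d) \<le> 4 + 2 * sqrt (sqrt (real n))"
      by simp
  qed simp
  finally show ?thesis by simp
qed

text \<open>The tolerance one covers both halves, of lengths n/2 rounded up and down;
  \<open>sqrt (1 / 2)\<close> is the limit of \<open>sqrt (m n / n)\<close>.\<close>

lemma half_deck_crossings_char:
  assumes "\<And>n. \<bar>real (m n) - real n / 2\<bar> \<le> 1"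
  shows "(\<lambda>n. mean (m n) (\<lambda>bs. iexp (t / sqrt (real n) * real_of_int (crossings bs))))
    \<longlonglongrightarrow> folded_normal_char (t * sqrt (1 / 2))"
proof (rule crossings_char)
  have m: "real n / 2 - 1 \<le> real (m n)" "real (m n) \<le> real n / 2 + 1" for n
    using assms[of n] by linarith+
  have "filterlim (\<lambda>n. real n / 2 - 1) at_top sequentially" by real_asymp
  then have "filterlim (\<lambda>n. real (m n)) at_top sequentially"
    by (rule filterlim_at_top_mono) (simp add: m)
  then show "filterlim m at_top sequentially"
    by (simp add: filterlim_sequentially_iff_filterlim_real)
  have "(\<lambda>n. real (m n) / real n) \<longlonglongrightarrow> 1 / 2"
  proof (rule tendsto_sandwich)
    show "\<forall>\<^sub>F n in sequentially. (real n / 2 - 1) / real n \<le> real (m n) / real n"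
      using m by (simp add: divide_right_mono)
    show "\<forall>\<^sub>F n in sequentially. real (m n) / real n \<le> (real n / 2 + 1) / real n"
      using m by (simp add: divide_right_mono)
    show "(\<lambda>n. (real n / 2 - 1) / real n) \<longlonglongrightarrow> 1 / 2" "(\<lambda>n. (real n / 2 + 1) / real n) \<longlonglongrightarrow> 1 / 2"
      by real_asymp+
  qed
  then have "(\<lambda>n. t * sqrt (real (m n) / real n)) \<longlonglongrightarrow> t * sqrt (1 / 2)"
    by (intro tendsto_mult tendsto_const tendsto_real_sqrt)
  then show "(\<lambda>n. t / sqrt (real n) * sqrt (real (m n))) \<longlonglongrightarrow> t * sqrt (1 / 2)"
    by (simp add: real_sqrt_divide)
qed

theorem mainTheorem1:
  fixes M :: "'a measure" and H1 H2 :: "'a \<Rightarrow> real"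
  assumes "prob_space M"
    and "prob_space.indep_var M borel H1 borel H2"
    and "distributed M lborel H1 (\<lambda>x. ennreal (half_normal_density x))"
    and "distributed M lborel H2 (\<lambda>x. ennreal (half_normal_density x))"
  shows "weak_conv_m
           (\<lambda>n. distr (measure_pmf (gsr_shuffle n)) borel
                  (\<lambda>deck. real (correct_guesses n deck) / sqrt (real n)))
           (distr M borel (\<lambda>\<omega>. H1 \<omega> + H2 \<omega>))
         \<and> distributed M lborel (\<lambda>\<omega>. H1 \<omega> + H2 \<omega>) (\<lambda>x. ennreal (limit_density x))"
proof
  interpret prob_space M by fact
  have [measurable]: "H1 \<in> borel_measurable M" "H2 \<in> borel_measurable M"
    using assms(3,4) by (auto dest: distributed_measurable)
  show "distributed M lborel (\<lambda>\<omega>. H1 \<omega> + H2 \<omega>) (\<lambda>x. ennreal (limit_density x))"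
    using distributed_convolution[OF assms(2-4)] unfolding half_normal_convolution .
  let ?X = "\<lambda>n. distr (measure_pmf (gsr_shuffle n)) borel (\<lambda>deck. real (correct_guesses n deck) / sqrt (real n))"
  show "weak_conv_m ?X (distr M borel (\<lambda>\<omega>. H1 \<omega> + H2 \<omega>))"
  proof (rule levy_continuity)
    show "real_distribution (?X n)" for n
      by (rule prob_space.real_distribution_distr[OF measure_pmf.prob_space_axioms]) simp
    show "real_distribution (distr M borel (\<lambda>\<omega>. H1 \<omega> + H2 \<omega>))"
      by (rule real_distribution_distr) measurable
    fix t :: real
    let ?h = "\<lambda>n. nat \<lceil>real n / 2\<rceil>"
    let ?e = "\<lambda>n m. mean m (\<lambda>bs. iexp (t / sqrt (real n) * real_of_int (crossings bs)))"
    let ?f = "folded_normal_char (t * sqrt (1 / 2))"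
    have "\<bar>real (?h n) - real n / 2\<bar> \<le> 1" "\<bar>real (n - ?h n) - real n / 2\<bar> \<le> 1" for n
      by linarith+
    then have "(\<lambda>n. ?e n (?h n) * ?e n (n - ?h n)) \<longlonglongrightarrow> ?f * ?f"
      by (intro tendsto_mult half_deck_crossings_char)
    moreover have "(\<lambda>n. char (?X n) t - ?e n (?h n) * ?e n (n - ?h n)) \<longlonglongrightarrow> 0"
    proof (rule Lim_null_comparison)
      show "\<forall>\<^sub>F n in sequentially. cmod (char (?X n) t - ?e n (?h n) * ?e n (n - ?h n))
          \<le> \<bar>t\<bar> / sqrt (real n) * (4 + 2 * sqrt (sqrt (real n)))"
        by (intro always_eventually allI correct_guesses_char_diff refl)
      show "(\<lambda>n. \<bar>t\<bar> / sqrt (real n) * (4 + 2 * sqrt (sqrt (real n)))) \<longlonglongrightarrow> 0"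
        by real_asymp
    qed
    ultimately have "(\<lambda>n. char (?X n) t) \<longlonglongrightarrow> ?f * ?f"
      by (rule Lim_transform)
    \<comment> \<open>By independence the characteristic function of the sum is the product of two
      equal half-normal factors.\<close>
    then show "(\<lambda>n. char (?X n) t) \<longlonglongrightarrow> char (distr M borel (\<lambda>\<omega>. H1 \<omega> + H2 \<omega>)) t"
      using assms by (simp add: char_distr_add char_half_normal)
  qed
qed

end
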